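(* Let $\underline{\gamma}^*=\{\gamma^{1,*},\dots,\gamma^{N,*}\}$ be a team policy and let $\psi^*_N,\psi^*_{N-1},\dots,\psi^*_1$ be obtained from it by the backward recursion $\psi^*_N=c$ and $\psi^*_{t-1}=T^*_t(\gamma^{t,*})\psi^*_t$ for $t=N,\dots,2$. Suppose that for every $1\le t\le N$ and every admissible $\pi_t$, $$J_t(\pi_t):=\langle \psi^*_t,\,T_t(\gamma^{t,*})\pi_t\rangle=\inf_{\gamma^t}\,\langle \psi^*_t,\,T_t(\gamma^t)\pi_t\rangle ,$$ where the infimum is over all control actions $\gamma^t$ at time $t$. Then $\underline{\gamma}^*$ is an optimal team policy.
   Context: Sequential team: there are $N$ decision makers (DMs) acting in the order $1,\dots,N$. $\Omega_0$, the measurement spaces $\mathbb{Y}^t$ and the action spaces $\mathbb{U}^t$ are standard Borel. A random variable $\omega_0\in\Omega_0$ has a given law $P(d\omega_0)$, and for each $t$ the measurement $y^t\in\mathbb{Y}^t$ is generated from $(\omega_0,y^1,\dots,y^{t-1},u^1,\dots,u^{t-1})$ by a given stochastic kernel $P(dy^t\mid \omega_0,y^1,\dots,y^{t-1},u^1,\dots,u^{t-1})$. DM $t$ observes only $y^t$ and chooses $u^t\in\mathbb{U}^t$. The loss $c(\omega_0,u^1,\dots,u^N)\ge 0$ is measurable. Control actions and policies: a control action $\gamma^t$ at time $t$ is a stochastic kernel $\gamma^t(du^t\mid y^t)$ from $\mathbb{Y}^t$ to $\mathbb{U}^t$ (deterministic measurable maps $\mathbb{Y}^t\to\mathbb{U}^t$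 are the special case of Dirac kernels). A team policy is a tuple $\underline\gamma=(\gamma^1,\dots,\gamma^N)$, with the actions drawn independently across DMs given their measurements; its cost is $J(\underline\gamma)=E^{\underline\gamma}[c(\omega_0,u^1,\dots,u^N)]$, and it is optimal if $J(\underline\gamma)$ equals the infimum of $J$ over all team policies. State: $x_t=(\omega_0,u^1,\dots,u^{t-1},y^1,\dots,y^t)$, and the extended state $\pi_t$ is a probability measure on $\Omega_0\times\prod_{i=1}^t\mathbb{Y}^i\times\prod_{i=1}^{t-1}\mathbb{U}^i$. An admissible $\pi_t$ is one that is the law of $x_t$ under some control actions $\gamma^1,\dots,\gamma^{t-1}$. Given $\pi_t$ and $\gamma^t$, the corresponding joint law of $(x_t,u^t)$ is $\pi_t(dx_t)\gamma^t(du^t\mid y^t)$, so that $u^t$ is conditionally independent of $x_t$ given $y^t$. Transition: for $t<N$, $T_t(\gamma^t)\pi_t$ is the law of $x_{t+1}$, i.e. the measure $P(dy^{t+1}\mid\omega_0,y^1,\dots,y^t,u^1,\dots,u^t)\,\gamma^t(du^t\mid y^t)\,\pi_t(dx_t)$; for $t=N$, $T_N(\gamma^N)\pi_N$ is the measure $\gamma^N(du^N\mid y^N)\pi_N(dx_N)$ on $\Omega_0\times\prod_{i=1}^N\mathbb{Y}^i\times\prod_{i=1}^N\mathbb{U}^i$. Pairing and adjoint: $\langle\psi,\nu\rangle=\int\psi\,d\nu$. The co-state $\psi_t$ is a measurable $[0,\infty]$-valued function of $x_{t+1}$ for $t<N$, and of $(\omega_0,y^1,\dots,y^N,u^1,\dots,u^N)$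 for $t=N$. The adjoint $T^*_t(\gamma^t)$ is defined by $\langle\psi_t,T_t(\gamma^t)\pi_t\rangle=\langle T^*_t(\gamma^t)\psi_t,\pi_t\rangle$; explicitly $(T^*_t(\gamma^t)\psi_t)(x_t)=E^{\gamma^t}[\psi_t\mid x_t]$. The terminal condition is $\psi_N(\omega_0,y^1,\dots,y^N,u^1,\dots,u^N)=c(\omega_0,u^1,\dots,u^N)$. *)

theory Defs
  imports "HOL-Probability.Probability"
begin

definition standard_borel :: "'a measure \<Rightarrow> bool" where
  "standard_borel M \<longleftrightarrow>
     (\<exists>X. topspace X = space M \<and> completely_metrizable_space X \<and> second_countable X \<and>
          sets M = sigma_sets (space M) {V. openin X V})"

text \<open>The decision makers are numbered from 1 to \<open>horizon\<close>. The spaces of different decision makers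
  are different carriers inside one common type \<^typ>\<open>'y\<close> (measurements) resp.\ \<^typ>\<open>'u\<close> (actions).
  Of \<open>meas_space\<close> and \<open>act_space\<close> only the \<open>\<sigma>\<close>-algebras matter; \<open>prior\<close> carries both
  the measurable space \<open>\<Omega>\<^sub>0\<close> and the law of \<open>\<omega>\<^sub>0\<close>.\<close>

record ('w, 'y, 'u) team =
  horizon :: nat
  prior :: "'w measure"
  meas_space :: "nat \<Rightarrow> 'y measure"
  act_space :: "nat \<Rightarrow> 'u measure"
  obs_kernel :: "nat \<Rightarrow> 'w \<times> (nat \<Rightarrow> 'y) \<times> (nat \<Rightarrow> 'u) \<Rightarrow> 'y measure"
  loss :: "'w \<times> (nat \<Rightarrow> 'u) \<Rightarrow> real"

text \<open>\<open>hist_space G t\<close> is the space of \<open>(\<omega>\<^sub>0, (y\<^sup>1,\<dots>,y\<^sup>t), (u\<^sup>1,\<dots>,u\<^sup>t))\<close>, and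
  \<open>state_space G t\<close> is the space of \<open>x\<^sub>t = (\<omega>\<^sub>0, (y\<^sup>1,\<dots>,y\<^sup>t), (u\<^sup>1,\<dots>,u\<^bsup>t-1\<^esup>))\<close>.\<close>

definition hist_space ::
  "('w, 'y, 'u) team \<Rightarrow> nat \<Rightarrow> ('w \<times> (nat \<Rightarrow> 'y) \<times> (nat \<Rightarrow> 'u)) measure" where
  "hist_space G t = prior G \<Otimes>\<^sub>M PiM {1..t} (meas_space G) \<Otimes>\<^sub>M PiM {1..t} (act_space G)"

definition state_space ::
  "('w, 'y, 'u) team \<Rightarrow> nat \<Rightarrow> ('w \<times> (nat \<Rightarrow> 'y) \<times> (nat \<Rightarrow> 'u)) measure" where
  "state_space G t = prior G \<Otimes>\<^sub>M PiM {1..t} (meas_space G) \<Otimes>\<^sub>M PiM {1..<t} (act_space G)"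

definition sequential_team :: "('w, 'y, 'u) team \<Rightarrow> bool" where
  "sequential_team G \<longleftrightarrow>
     1 \<le> horizon G \<and>
     prob_space (prior G) \<and> standard_borel (prior G) \<and>
     (\<forall>t\<in>{1..horizon G}. standard_borel (meas_space G t) \<and> standard_borel (act_space G t) \<and>
        obs_kernel G t \<in> hist_space G (t - 1) \<rightarrow>\<^sub>M prob_algebra (meas_space G t)) \<and>
     loss G \<in> borel_measurable (prior G \<Otimes>\<^sub>M PiM {1..horizon G} (act_space G)) \<and>
     (\<forall>z\<in>space (prior G \<Otimes>\<^sub>M PiM {1..horizon G} (act_space G)). 0 \<le> loss G z)"

definition control_actions :: "('w, 'y, 'u) team \<Rightarrow> nat \<Rightarrow> ('y \<Rightarrow> 'u measure) set" where
  "control_actions G t = meas_space G t \<rightarrow>\<^sub>M prob_algebra (act_space G t)"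

definition team_policies :: "('w, 'y, 'u) team \<Rightarrow> (nat \<Rightarrow> 'y \<Rightarrow> 'u measure) set" where
  "team_policies G = {\<gamma>. \<forall>t\<in>{1..horizon G}. \<gamma> t \<in> control_actions G t}"

text \<open>\<open>act_law G t g \<pi>\<close> is the joint law \<open>\<pi>(dx\<^sub>t) g(du\<^sup>t | y\<^sup>t)\<close> of \<open>(x\<^sub>t, u\<^sup>t)\<close>;
  \<open>obs_law G t \<nu>\<close> extends a law \<open>\<nu>\<close> of \<open>(x\<^sub>t, u\<^sup>t)\<close> by
  \<open>P(dy\<^bsup>t+1\<^esup> | \<omega>\<^sub>0, y\<^sup>1,\<dots>,y\<^sup>t, u\<^sup>1,\<dots>,u\<^sup>t)\<close>.\<close>

definition act_law ::
  "('w, 'y, 'u) team \<Rightarrow> nat \<Rightarrow> ('y \<Rightarrow> 'u measure) \<Rightarrow>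
   ('w \<times> (nat \<Rightarrow> 'y) \<times> (nat \<Rightarrow> 'u)) measure \<Rightarrow> ('w \<times> (nat \<Rightarrow> 'y) \<times> (nat \<Rightarrow> 'u)) measure" where
  "act_law G t g \<pi> =
     \<pi> \<bind> (\<lambda>(w, y, u). distr (g (y t)) (hist_space G t) (\<lambda>a. (w, y, u(t := a))))"

definition obs_law ::
  "('w, 'y, 'u) team \<Rightarrow> nat \<Rightarrow>
   ('w \<times> (nat \<Rightarrow> 'y) \<times> (nat \<Rightarrow> 'u)) measure \<Rightarrow> ('w \<times> (nat \<Rightarrow> 'y) \<times> (nat \<Rightarrow> 'u)) measure" where
  "obs_law G t \<nu> =
     \<nu> \<bind> (\<lambda>(w, y, u). distr (obs_kernel G (Suc t) (w, y, u)) (state_space G (Suc t))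
                          (\<lambda>b. (w, y(Suc t := b), u)))"

text \<open>\<open>hist_law G \<gamma> t\<close> is the law of \<open>(\<omega>\<^sub>0, y\<^sup>1,\<dots>,y\<^sup>t, u\<^sup>1,\<dots>,u\<^sup>t)\<close> under \<open>\<gamma>\<close>. The empty tuple is
  \<open>\<lambda>_. undefined\<close>, the only element of a product over the empty index set.\<close>

primrec hist_law ::
  "('w, 'y, 'u) team \<Rightarrow> (nat \<Rightarrow> 'y \<Rightarrow> 'u measure) \<Rightarrow> nat \<Rightarrow>
   ('w \<times> (nat \<Rightarrow> 'y) \<times> (nat \<Rightarrow> 'u)) measure" where
  "hist_law G \<gamma> 0 = distr (prior G) (hist_space G 0) (\<lambda>w. (w, (\<lambda>_. undefined), (\<lambda>_. undefined)))"
| "hist_law G \<gamma> (Suc t) = act_law G (Suc t) (\<gamma> (Suc t)) (obs_law G t (hist_law G \<gamma> t))"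

definition state_law ::
  "('w, 'y, 'u) team \<Rightarrow> (nat \<Rightarrow> 'y \<Rightarrow> 'u measure) \<Rightarrow> nat \<Rightarrow>
   ('w \<times> (nat \<Rightarrow> 'y) \<times> (nat \<Rightarrow> 'u)) measure" where
  "state_law G \<gamma> t = obs_law G (t - 1) (hist_law G \<gamma> (t - 1))"

definition team_cost :: "('w, 'y, 'u) team \<Rightarrow> (nat \<Rightarrow> 'y \<Rightarrow> 'u measure) \<Rightarrow> ennreal" where
  "team_cost G \<gamma> = (\<integral>\<^sup>+ (w, y, u). ennreal (loss G (w, u)) \<partial>hist_law G \<gamma> (horizon G))"

definition optimal_policy :: "('w, 'y, 'u) team \<Rightarrow> (nat \<Rightarrow> 'y \<Rightarrow> 'u measure) \<Rightarrow> bool" where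
  "optimal_policy G \<gamma> \<longleftrightarrow>
     \<gamma> \<in> team_policies G \<and> team_cost G \<gamma> = (INF \<gamma>'\<in>team_policies G. team_cost G \<gamma>')"

definition admissible ::
  "('w, 'y, 'u) team \<Rightarrow> nat \<Rightarrow> ('w \<times> (nat \<Rightarrow> 'y) \<times> (nat \<Rightarrow> 'u)) measure \<Rightarrow> bool" where
  "admissible G t \<pi> \<longleftrightarrow>
     (\<exists>\<gamma>. (\<forall>s\<in>{1..<t}. \<gamma> s \<in> control_actions G s) \<and> \<pi> = state_law G \<gamma> t)"

definition transition ::
  "('w, 'y, 'u) team \<Rightarrow> nat \<Rightarrow> ('y \<Rightarrow> 'u measure) \<Rightarrow>
   ('w \<times> (nat \<Rightarrow> 'y) \<times> (nat \<Rightarrow> 'u)) measure \<Rightarrow> ('w \<times> (nat \<Rightarrow> 'y) \<times> (nat \<Rightarrow> 'u)) measure" where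
  "transition G t g \<pi> = (if t < horizon G then obs_law G t (act_law G t g \<pi>) else act_law G t g \<pi>)"

text \<open>The space on which \<open>transition G t g \<pi>\<close> lives and on which the co-state \<open>\<psi>\<^sub>t\<close> is defined.\<close>

definition costate_space ::
  "('w, 'y, 'u) team \<Rightarrow> nat \<Rightarrow> ('w \<times> (nat \<Rightarrow> 'y) \<times> (nat \<Rightarrow> 'u)) measure" where
  "costate_space G t = (if t < horizon G then state_space G (Suc t) else hist_space G t)"

text \<open>\<open>adjoint_op G t g \<psi> x\<close> is \<open>E\<^sup>g[\<psi> | x\<^sub>t = x]\<close>; see \<open>adjoint_pairing\<close> below.\<close>

definition adjoint_op ::
  "('w, 'y, 'u) team \<Rightarrow> nat \<Rightarrow> ('y \<Rightarrow> 'u measure) \<Rightarrow>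
   ('w \<times> (nat \<Rightarrow> 'y) \<times> (nat \<Rightarrow> 'u) \<Rightarrow> ennreal) \<Rightarrow> 'w \<times> (nat \<Rightarrow> 'y) \<times> (nat \<Rightarrow> 'u) \<Rightarrow> ennreal" where
  "adjoint_op G t g \<psi> = (\<lambda>(w, y, u).
     \<integral>\<^sup>+ a. (if t < horizon G
             then \<integral>\<^sup>+ b. \<psi> (w, y(Suc t := b), u(t := a)) \<partial>obs_kernel G (Suc t) (w, y, u(t := a))
             else \<psi> (w, y, u(t := a))) \<partial>g (y t))"

lemma act_kernel_measurable:
  assumes t: "1 \<le> t" and g: "g \<in> control_actions G t"
  shows "(\<lambda>(w, y, u). distr (g (y t)) (hist_space G t) (\<lambda>a. (w, y, u(t := a))))
           \<in> state_space G t \<rightarrow>\<^sub>M subprob_algebra (hist_space G t)"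
proof -
  have g': "g \<in> meas_space G t \<rightarrow>\<^sub>M subprob_algebra (act_space G t)"
    using g unfolding control_actions_def by (rule measurable_prob_algebraD)
  have y: "(\<lambda>x. fst (snd x) t) \<in> state_space G t \<rightarrow>\<^sub>M meas_space G t"
    unfolding state_space_def using t
    by (intro measurable_compose[OF measurable_compose[OF measurable_snd measurable_fst]
          measurable_component_singleton]) auto
  have u: "(\<lambda>p. (snd (snd (fst p)))(t := snd p)) \<in>
      state_space G t \<Otimes>\<^sub>M act_space G t \<rightarrow>\<^sub>M PiM {1..t} (act_space G)"
    unfolding state_space_def using t
    by (intro measurable_fun_upd[where J = "{1..<t}"]) (auto, measurable)
  have f: "(\<lambda>(x, a). (fst x, fst (snd x), (snd (snd x))(t := a))) \<in>
      state_space G t \<Otimes>\<^sub>M act_space G t \<rightarrow>\<^sub>M hist_space G t"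
    unfolding hist_space_def case_prod_beta
    by (intro measurable_Pair u) (simp_all add: state_space_def)
  show ?thesis
    unfolding case_prod_beta
    using measurable_distr2[OF f measurable_compose[OF y g']] by simp
qed

lemma obs_kernel_measurable:
  assumes G: "sequential_team G" and t: "t < horizon G"
  shows "(\<lambda>(w, y, u). distr (obs_kernel G (Suc t) (w, y, u)) (state_space G (Suc t))
                          (\<lambda>b. (w, y(Suc t := b), u)))
           \<in> hist_space G t \<rightarrow>\<^sub>M subprob_algebra (state_space G (Suc t))"
proof -
  have "Suc t \<in> {1..horizon G}"
    using t by simp
  then have "obs_kernel G (Suc t) \<in> hist_space G (Suc t - 1) \<rightarrow>\<^sub>M prob_algebra (meas_space G (Suc t))"
    using G unfolding sequential_team_def by blast
  then have k: "obs_kernel G (Suc t) \<in> hist_space G t \<rightarrow>\<^sub>M subprob_algebra (meas_space G (Suc t))"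
    by (simp add: measurable_prob_algebraD)
  have y: "(\<lambda>p. (fst (snd (fst p)))(Suc t := snd p)) \<in>
      hist_space G t \<Otimes>\<^sub>M meas_space G (Suc t) \<rightarrow>\<^sub>M PiM {1..Suc t} (meas_space G)"
    unfolding hist_space_def
    by (intro measurable_fun_upd[where J = "{1..t}"]) (auto, measurable)
  have f: "(\<lambda>(x, b). (fst x, (fst (snd x))(Suc t := b), snd (snd x))) \<in>
      hist_space G t \<Otimes>\<^sub>M meas_space G (Suc t) \<rightarrow>\<^sub>M state_space G (Suc t)"
    unfolding state_space_def case_prod_beta
    by (intro measurable_Pair y) (simp_all add: hist_space_def atLeastLessThanSuc_atLeastAtMost)
  show ?thesis
    unfolding case_prod_beta
    using measurable_distr2[OF f k] by simp
qed

lemma sets_act_law: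
  assumes "1 \<le> t" "g \<in> control_actions G t" "sets \<pi> = sets (state_space G t)" "space \<pi> \<noteq> {}"
  shows "sets (act_law G t g \<pi>) = sets (hist_space G t)"
  unfolding act_law_def using assms
  by (intro sets_bind[OF sets_kernel[OF act_kernel_measurable]])
     (auto dest: sets_eq_imp_space_eq)

lemma nn_integral_act_law:
  assumes "1 \<le> t" "g \<in> control_actions G t" "sets \<pi> = sets (state_space G t)"
    and \<psi>: "\<psi> \<in> borel_measurable (hist_space G t)"
  shows "(\<integral>\<^sup>+ x. \<psi> x \<partial>act_law G t g \<pi>) = (\<integral>\<^sup>+ (w, y, u). (\<integral>\<^sup>+ a. \<psi> (w, y, u(t := a)) \<partial>g (y t)) \<partial>\<pi>)"
proof -
  have m: "(\<lambda>(w, y, u). distr (g (y t)) (hist_space G t) (\<lambda>a. (w, y, u(t := a))))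
           \<in> \<pi> \<rightarrow>\<^sub>M subprob_algebra (hist_space G t)"
    using act_kernel_measurable[OF assms(1,2)] assms(3) by (simp cong: measurable_cong_sets)
  have "(\<integral>\<^sup>+ x. \<psi> x \<partial>act_law G t g \<pi>) =
      (\<integral>\<^sup>+ z. (\<integral>\<^sup>+ x. \<psi> x \<partial>(case z of (w, y, u) \<Rightarrow>
         distr (g (y t)) (hist_space G t) (\<lambda>a. (w, y, u(t := a))))) \<partial>\<pi>)"
    unfolding act_law_def by (rule nn_integral_bind[OF \<psi> m])
  also have "\<dots> = (\<integral>\<^sup>+ (w, y, u). (\<integral>\<^sup>+ a. \<psi> (w, y, u(t := a)) \<partial>g (y t)) \<partial>\<pi>)"
  proof (rule nn_integral_cong, clarify)
    fix w y u assume "(w, y, u) \<in> space \<pi>"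
    then have x: "w \<in> space (prior G)" "y \<in> space (PiM {1..t} (meas_space G))"
        "u \<in> space (PiM {1..<t} (act_space G))"
      using sets_eq_imp_space_eq[OF assms(3)] by (auto simp: state_space_def space_pair_measure)
    have "y t \<in> space (meas_space G t)"
      using x(2) assms(1) by (auto simp: space_PiM)
    then have s: "sets (g (y t)) = sets (act_space G t)"
      using assms(2) by (auto simp: control_actions_def space_prob_algebra dest: measurable_space)
    have "(\<lambda>a. u(t := a)) \<in> g (y t) \<rightarrow>\<^sub>M PiM {1..t} (act_space G)"
      using x(3) assms(1)
      by (intro measurable_fun_upd[where J = "{1..<t}"]) (auto cong: measurable_cong_sets simp: s)
    then have "(\<lambda>a. (w, y, u(t := a))) \<in> g (y t) \<rightarrow>\<^sub>M hist_space G t"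
      unfolding hist_space_def using x by (intro measurable_Pair) auto
    then show "(\<integral>\<^sup>+ x. \<psi> x \<partial>distr (g (y t)) (hist_space G t) (\<lambda>a. (w, y, u(t := a)))) =
        (\<integral>\<^sup>+ a. \<psi> (w, y, u(t := a)) \<partial>g (y t))"
      using \<psi> by (simp add: nn_integral_distr)
  qed
  finally show ?thesis .
qed

lemma nn_integral_obs_law:
  assumes "sequential_team G" "t < horizon G" "sets \<nu> = sets (hist_space G t)"
    and \<psi>: "\<psi> \<in> borel_measurable (state_space G (Suc t))"
  shows "(\<integral>\<^sup>+ x. \<psi> x \<partial>obs_law G t \<nu>) =
    (\<integral>\<^sup>+ (w, y, u). (\<integral>\<^sup>+ b. \<psi> (w, y(Suc t := b), u) \<partial>obs_kernel G (Suc t) (w, y, u)) \<partial>\<nu>)"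
    and "(\<lambda>(w, y, u). \<integral>\<^sup>+ b. \<psi> (w, y(Suc t := b), u) \<partial>obs_kernel G (Suc t) (w, y, u))
           \<in> borel_measurable (hist_space G t)"
proof -
  let ?K = "\<lambda>(w, y, u). distr (obs_kernel G (Suc t) (w, y, u)) (state_space G (Suc t))
                          (\<lambda>b. (w, y(Suc t := b), u))"
  have K: "?K \<in> hist_space G t \<rightarrow>\<^sub>M subprob_algebra (state_space G (Suc t))"
    by (rule obs_kernel_measurable[OF assms(1,2)])
  have m: "?K \<in> \<nu> \<rightarrow>\<^sub>M subprob_algebra (state_space G (Suc t))"
    using K assms(3) by (simp cong: measurable_cong_sets)
  have eq: "(\<integral>\<^sup>+ x. \<psi> x \<partial>?K z) =
      (case z of (w, y, u) \<Rightarrow> \<integral>\<^sup>+ b. \<psi> (w, y(Suc t := b), u) \<partial>obs_kernel G (Suc t) (w, y, u))"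
    if z: "z \<in> space (hist_space G t)" for z
  proof -
    obtain w y u where zz: "z = (w, y, u)" by (cases z)
    have x: "w \<in> space (prior G)" "y \<in> space (PiM {1..t} (meas_space G))"
        "u \<in> space (PiM {1..<Suc t} (act_space G))"
      using z zz by (auto simp: hist_space_def space_pair_measure atLeastLessThanSuc_atLeastAtMost)
    have "Suc t \<in> {1..horizon G}"
      using assms(2) by simp
    then have "obs_kernel G (Suc t) \<in> hist_space G (Suc t - 1) \<rightarrow>\<^sub>M prob_algebra (meas_space G (Suc t))"
      using assms(1) unfolding sequential_team_def by blast
    then have s: "sets (obs_kernel G (Suc t) (w, y, u)) = sets (meas_space G (Suc t))"
      using z zz by (auto simp: space_prob_algebra dest: measurable_space)
    have "(\<lambda>b. y(Suc t := b)) \<in> obs_kernel G (Suc t) (w, y, u) \<rightarrow>\<^sub>M PiM {1..Suc t} (meas_space G)"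
      using x(2)
      by (intro measurable_fun_upd[where J = "{1..t}"]) (auto cong: measurable_cong_sets simp: s)
    then have "(\<lambda>b. (w, y(Suc t := b), u)) \<in> obs_kernel G (Suc t) (w, y, u) \<rightarrow>\<^sub>M state_space G (Suc t)"
      unfolding state_space_def using x by (intro measurable_Pair) auto
    then show ?thesis
      using \<psi> unfolding zz prod.case by (simp add: nn_integral_distr)
  qed
  have "(\<integral>\<^sup>+ x. \<psi> x \<partial>obs_law G t \<nu>) = (\<integral>\<^sup>+ z. (\<integral>\<^sup>+ x. \<psi> x \<partial>?K z) \<partial>\<nu>)"
    unfolding obs_law_def by (rule nn_integral_bind[OF \<psi> m])
  also have "\<dots> = (\<integral>\<^sup>+ (w, y, u). (\<integral>\<^sup>+ b. \<psi> (w, y(Suc t := b), u) \<partial>obs_kernel G (Suc t) (w, y, u)) \<partial>\<nu>)"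
    by (intro nn_integral_cong eq) (use sets_eq_imp_space_eq[OF assms(3)] in simp)
  finally show "(\<integral>\<^sup>+ x. \<psi> x \<partial>obs_law G t \<nu>) =
    (\<integral>\<^sup>+ (w, y, u). (\<integral>\<^sup>+ b. \<psi> (w, y(Suc t := b), u) \<partial>obs_kernel G (Suc t) (w, y, u)) \<partial>\<nu>)" .
  have "(\<lambda>z. \<integral>\<^sup>+ x. \<psi> x \<partial>?K z) \<in> borel_measurable (hist_space G t)"
    using measurable_compose[OF K nn_integral_measurable_subprob_algebra[OF \<psi>]] .
  then show "(\<lambda>(w, y, u). \<integral>\<^sup>+ b. \<psi> (w, y(Suc t := b), u) \<partial>obs_kernel G (Suc t) (w, y, u))
           \<in> borel_measurable (hist_space G t)"
    by (subst measurable_cong[OF eq, symmetric])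
qed

text \<open>The defining identity of the adjoint, for every probability measure on the state space.\<close>

lemma adjoint_pairing:
  assumes G: "sequential_team G" and t: "t \<in> {1..horizon G}" and g: "g \<in> control_actions G t"
    and \<psi>: "\<psi> \<in> borel_measurable (costate_space G t)"
    and \<pi>: "sets \<pi> = sets (state_space G t)" "prob_space \<pi>"
  shows "(\<integral>\<^sup>+ x. \<psi> x \<partial>transition G t g \<pi>) = (\<integral>\<^sup>+ x. adjoint_op G t g \<psi> x \<partial>\<pi>)"
proof (cases "t < horizon G")
  case True
  have "1 \<le> t" using t by simp
  have \<psi>': "\<psi> \<in> borel_measurable (state_space G (Suc t))"
    using \<psi> True by (simp add: costate_space_def)
  have "sets (act_law G t g \<pi>) = sets (hist_space G t)"
    using sets_act_law[OF \<open>1 \<le> t\<close> g \<pi>(1)] prob_space.not_empty[OF \<pi>(2)] by simp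
  from nn_integral_obs_law[OF G True this \<psi>'] nn_integral_act_law[OF \<open>1 \<le> t\<close> g \<pi>(1)] True
  show ?thesis
    by (simp add: transition_def adjoint_op_def)
next
  case False
  then show ?thesis
    using nn_integral_act_law[OF _ g \<pi>(1), of \<psi>] t \<psi>
    by (simp add: transition_def adjoint_op_def costate_space_def)
qed

end

theory Submission
  imports Defs
begin

text \<open>Write \<open>A\<^sub>t(\<gamma>) = \<langle>\<psi>\<^sub>t, T\<^sub>t(\<gamma>\<^sup>t) \<pi>\<^sub>t\<rangle>\<close>, where \<open>\<pi>\<^sub>t\<close> is the law of the state
  \<open>x\<^sub>t\<close> under the policy \<open>\<gamma>\<close>. Since \<open>\<psi>\<^sub>t\<close> integrates the loss when the decision makers after \<open>t\<close> follow
  \<open>\<gamma>\<^sup>*\<close>, the number \<open>A\<^sub>t(\<gamma>)\<close> is the cost of the hybrid policy that uses \<open>\<gamma>\<close> up to time \<open>t\<close> and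
  \<open>\<gamma>\<^sup>*\<close> afterwards; in particular \<open>A\<^sub>N\<close> is the team cost. Passing from \<open>t\<close> to \<open>t + 1\<close> replaces one
  more action of the hybrid, and duality splits this into an identity and an inequality:
  \<open>A\<^sub>t(\<gamma>) = \<langle>\<psi>\<^sub>t, \<pi>\<^bsub>t+1\<^esub>\<rangle> = \<langle>\<psi>\<^bsub>t+1\<^esub>, T\<^bsub>t+1\<^esub>(\<gamma>\<^bsup>*,t+1\<^esup>) \<pi>\<^bsub>t+1\<^esub>\<rangle>
  \<le> \<langle>\<psi>\<^bsub>t+1\<^esub>, T\<^bsub>t+1\<^esub>(\<gamma>\<^bsup>t+1\<^esup>) \<pi>\<^bsub>t+1\<^esub>\<rangle> = A\<^bsub>t+1\<^esub>(\<gamma>)\<close>.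
  The identities are the forward recursion of the laws and the backward recursion of the co-states;
  the inequality is the stationarity hypothesis at the admissible law \<open>\<pi>\<^bsub>t+1\<^esub>\<close>, and it is an equality
  for \<open>\<gamma> = \<gamma>\<^sup>*\<close>. The law \<open>\<pi>\<^sub>1\<close> is the same for all policies, so \<open>A\<^sub>1(\<gamma>\<^sup>*) \<le> A\<^sub>1(\<gamma>)\<close>, and induction
  on \<open>t\<close> gives \<open>A\<^sub>N(\<gamma>\<^sup>*) \<le> A\<^sub>N(\<gamma>)\<close> for every \<open>\<gamma>\<close>.

  The inequality is applied along the trajectory of the competitor \<open>\<gamma>\<close>, which is why
  stationarity is required at every admissible law and not only at those generated by \<open>\<gamma>\<^sup>*\<close>.
  Two facts make the pairing legitimate: the laws of the states are probability measures on
  the state spaces, and the co-states are measurable.\<close>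

section \<open>Laws of histories and states\<close>

lemma obs_kernel_prob_algebra:
  assumes "sequential_team G" "t < horizon G"
  shows "obs_kernel G (Suc t) \<in> hist_space G t \<rightarrow>\<^sub>M prob_algebra (meas_space G (Suc t))"
proof -
  have "Suc t \<in> {1..horizon G}"
    using assms(2) by simp
  then have "obs_kernel G (Suc t) \<in> hist_space G (Suc t - 1) \<rightarrow>\<^sub>M prob_algebra (meas_space G (Suc t))"
    using assms(1) unfolding sequential_team_def by blast
  then show ?thesis by simp
qed

lemma append_action_measurable:
  assumes "1 \<le> t"
  shows "(\<lambda>(x, a). (fst x, fst (snd x), (snd (snd x))(t := a)))
    \<in> state_space G t \<Otimes>\<^sub>M act_space G t \<rightarrow>\<^sub>M hist_space G t"
proof -
  have "(\<lambda>p. (snd (snd (fst p)))(t := snd p)) \<in>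
      state_space G t \<Otimes>\<^sub>M act_space G t \<rightarrow>\<^sub>M PiM {1..t} (act_space G)"
    unfolding state_space_def using assms
    by (intro measurable_fun_upd[where J = "{1..<t}"]) (auto, measurable)
  then show ?thesis
    unfolding hist_space_def case_prod_beta
    by (intro measurable_Pair) (simp_all add: state_space_def)
qed

lemma append_observation_measurable:
  "(\<lambda>(x, b). (fst x, (fst (snd x))(Suc t := b), snd (snd x)))
    \<in> hist_space G t \<Otimes>\<^sub>M meas_space G (Suc t) \<rightarrow>\<^sub>M state_space G (Suc t)"
proof -
  have "(\<lambda>p. (fst (snd (fst p)))(Suc t := snd p)) \<in>
      hist_space G t \<Otimes>\<^sub>M meas_space G (Suc t) \<rightarrow>\<^sub>M PiM {1..Suc t} (meas_space G)"
    unfolding hist_space_def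
    by (intro measurable_fun_upd[where J = "{1..t}"]) (auto, measurable)
  then show ?thesis
    unfolding state_space_def case_prod_beta
    by (intro measurable_Pair) (simp_all add: hist_space_def atLeastLessThanSuc_atLeastAtMost)
qed

lemma current_observation_measurable:
  assumes "1 \<le> t"
  shows "(\<lambda>x. fst (snd x) t) \<in> state_space G t \<rightarrow>\<^sub>M meas_space G t"
  unfolding state_space_def using assms
  by (intro measurable_compose[OF measurable_compose[OF measurable_snd measurable_fst]
        measurable_component_singleton]) auto

lemma prob_space_act_law:
  assumes t: "1 \<le> t" and g: "g \<in> control_actions G t"
    and \<pi>: "sets \<pi> = sets (state_space G t)" "prob_space \<pi>"
  shows "prob_space (act_law G t g \<pi>)"
proof -
  interpret prob_space \<pi> by fact
  let ?K = "\<lambda>(w, y, u). distr (g (y t)) (hist_space G t) (\<lambda>a. (w, y, u(t := a)))"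
  have K: "?K \<in> \<pi> \<rightarrow>\<^sub>M subprob_algebra (hist_space G t)"
    using act_kernel_measurable[OF t g] \<pi>(1) by (simp cong: measurable_cong_sets)
  have "prob_space (?K x)" if x: "x \<in> space \<pi>" for x
  proof -
    have x': "x \<in> space (state_space G t)"
      using x sets_eq_imp_space_eq[OF \<pi>(1)] by simp
    have "g (fst (snd x) t) \<in> space (prob_algebra (act_space G t))"
      using g measurable_space[OF current_observation_measurable[OF t] x']
      unfolding control_actions_def by (rule measurable_space)
    then have p: "prob_space (g (fst (snd x) t))"
      and s: "sets (g (fst (snd x) t)) = sets (act_space G t)"
      by (auto simp: space_prob_algebra)
    have "(\<lambda>a. (fst x, fst (snd x), (snd (snd x))(t := a)))
        \<in> g (fst (snd x) t) \<rightarrow>\<^sub>M hist_space G t"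
      using measurable_compose[OF measurable_Pair1'[OF x'] append_action_measurable[OF t]]
      by (simp add: measurable_cong_sets[OF s refl])
    then show ?thesis
      using prob_space.prob_space_distr[OF p] by (simp add: case_prod_beta)
  qed
  then show ?thesis
    unfolding act_law_def by (intro prob_space_bind[OF _ K] AE_I2)
qed

lemma sets_obs_law:
  assumes "sequential_team G" "t < horizon G" "sets \<nu> = sets (hist_space G t)" "space \<nu> \<noteq> {}"
  shows "sets (obs_law G t \<nu>) = sets (state_space G (Suc t))"
  unfolding obs_law_def using assms
  by (intro sets_bind[OF sets_kernel[OF obs_kernel_measurable]])
     (auto dest: sets_eq_imp_space_eq)

lemma prob_space_obs_law:
  assumes G: "sequential_team G" and t: "t < horizon G"
    and \<nu>: "sets \<nu> = sets (hist_space G t)" "prob_space \<nu>"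
  shows "prob_space (obs_law G t \<nu>)"
proof -
  interpret prob_space \<nu> by fact
  let ?K = "\<lambda>(w, y, u). distr (obs_kernel G (Suc t) (w, y, u)) (state_space G (Suc t))
                          (\<lambda>b. (w, y(Suc t := b), u))"
  have K: "?K \<in> \<nu> \<rightarrow>\<^sub>M subprob_algebra (state_space G (Suc t))"
    using obs_kernel_measurable[OF G t] \<nu>(1) by (simp cong: measurable_cong_sets)
  have "prob_space (?K x)" if x: "x \<in> space \<nu>" for x
  proof -
    have x': "x \<in> space (hist_space G t)"
      using x sets_eq_imp_space_eq[OF \<nu>(1)] by simp
    have "obs_kernel G (Suc t) x \<in> space (prob_algebra (meas_space G (Suc t)))"
      using measurable_space[OF obs_kernel_prob_algebra[OF G t] x'] .
    then have p: "prob_space (obs_kernel G (Suc t) x)"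
      and s: "sets (obs_kernel G (Suc t) x) = sets (meas_space G (Suc t))"
      by (auto simp: space_prob_algebra)
    have "(\<lambda>b. (fst x, (fst (snd x))(Suc t := b), snd (snd x)))
        \<in> obs_kernel G (Suc t) x \<rightarrow>\<^sub>M state_space G (Suc t)"
      using measurable_compose[OF measurable_Pair1'[OF x'] append_observation_measurable]
      by (simp add: measurable_cong_sets[OF s refl])
    then show ?thesis
      using prob_space.prob_space_distr[OF p] by (simp add: case_prod_beta)
  qed
  then show ?thesis
    unfolding obs_law_def by (intro prob_space_bind[OF _ K] AE_I2)
qed

lemma hist_law_prob:
  assumes G: "sequential_team G"
  shows "t \<le> horizon G \<Longrightarrow> (\<forall>s\<in>{1..t}. \<gamma> s \<in> control_actions G s) \<Longrightarrow>
    sets (hist_law G \<gamma> t) = sets (hist_space G t) \<and> prob_space (hist_law G \<gamma> t)"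
proof (induction t)
  case 0
  have "(\<lambda>w. (w, (\<lambda>_. undefined), (\<lambda>_. undefined))) \<in> prior G \<rightarrow>\<^sub>M hist_space G 0"
    unfolding hist_space_def
    by (intro measurable_Pair measurable_const) (auto simp: space_PiM)
  moreover have "prob_space (prior G)"
    using G by (simp add: sequential_team_def)
  ultimately show ?case
    by (simp add: prob_space.prob_space_distr)
next
  case (Suc t)
  then have t: "t < horizon G" and \<gamma>: "\<gamma> (Suc t) \<in> control_actions G (Suc t)"
    and h: "sets (hist_law G \<gamma> t) = sets (hist_space G t)" "prob_space (hist_law G \<gamma> t)"
    by simp_all
  note sets = sets_obs_law[OF G t h(1) prob_space.not_empty[OF h(2)]]
  note prob = prob_space_obs_law[OF G t h]
  show ?case
    using sets_act_law[OF _ \<gamma> sets prob_space.not_empty[OF prob]]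
      prob_space_act_law[OF _ \<gamma> sets prob] by simp
qed

lemma state_law_prob:
  assumes G: "sequential_team G" and t: "t \<in> {1..horizon G}"
    and \<gamma>: "\<forall>s\<in>{1..<t}. \<gamma> s \<in> control_actions G s"
  shows "sets (state_law G \<gamma> t) = sets (state_space G t)" "prob_space (state_law G \<gamma> t)"
proof -
  have t': "t - 1 < horizon G" "Suc (t - 1) = t"
    using t by auto
  then have h: "sets (hist_law G \<gamma> (t - 1)) = sets (hist_space G (t - 1))"
      "prob_space (hist_law G \<gamma> (t - 1))"
    using hist_law_prob[OF G, of "t - 1" \<gamma>] \<gamma> by auto
  show "sets (state_law G \<gamma> t) = sets (state_space G t)"
    using sets_obs_law[OF G t'(1) h(1) prob_space.not_empty[OF h(2)]] t'(2)
    by (simp add: state_law_def)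
  show "prob_space (state_law G \<gamma> t)"
    using prob_space_obs_law[OF G t'(1) h] by (simp add: state_law_def)
qed

lemma transition_state_law:
  assumes "1 \<le> t" "t < horizon G"
  shows "transition G t (\<gamma> t) (state_law G \<gamma> t) = state_law G \<gamma> (Suc t)"
  using assms by (cases t) (simp_all add: transition_def state_law_def)

lemma transition_horizon:
  assumes "1 \<le> horizon G"
  shows "transition G (horizon G) (\<gamma> (horizon G)) (state_law G \<gamma> (horizon G))
    = hist_law G \<gamma> (horizon G)"
  using assms by (cases "horizon G") (simp_all add: transition_def state_law_def)

section \<open>Measurability of the co-states\<close>

lemma adjoint_op_measurable:
  assumes G: "sequential_team G" and t: "t \<in> {1..horizon G}" and g: "g \<in> control_actions G t"
    and \<psi>: "\<psi> \<in> borel_measurable (costate_space G t)"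
  shows "adjoint_op G t g \<psi> \<in> borel_measurable (state_space G t)"
proof -
  \<comment> \<open>The co-state with the next observation, if there is one, integrated out.\<close>
  define h where "h = (if t < horizon G
    then (\<lambda>(w, y, u). \<integral>\<^sup>+ b. \<psi> (w, y(Suc t := b), u) \<partial>obs_kernel G (Suc t) (w, y, u)) else \<psi>)"
  have t1: "1 \<le> t" using t by simp
  have h: "h \<in> borel_measurable (hist_space G t)"
    using \<psi> nn_integral_obs_law(2)[OF G _ refl, of t \<psi>] by (auto simp: h_def costate_space_def)
  have "g \<in> meas_space G t \<rightarrow>\<^sub>M subprob_algebra (act_space G t)"
    using g unfolding control_actions_def by (rule measurable_prob_algebraD)
  then have k: "(\<lambda>x. g (fst (snd x) t)) \<in> state_space G t \<rightarrow>\<^sub>M subprob_algebra (act_space G t)"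
    by (rule measurable_compose[OF current_observation_measurable[OF t1]])
  have "(\<lambda>(x, a). h (fst x, fst (snd x), (snd (snd x))(t := a)))
      \<in> borel_measurable (state_space G t \<Otimes>\<^sub>M act_space G t)"
    using measurable_compose[OF append_action_measurable[OF t1] h] by (simp add: case_prod_beta)
  from nn_integral_measurable_subprob_algebra2[OF this k]
  show ?thesis
    by (cases "t < horizon G") (simp_all add: adjoint_op_def h_def case_prod_beta)
qed

text \<open>Measurability is inherited backwards in time from the loss, because the adjoint integrates
  against stochastic kernels.\<close>

lemma costate_measurable:
  assumes G: "sequential_team G" and \<gamma>: "\<gamma> \<in> team_policies G"
    and terminal: "\<forall>(w, y, u)\<in>space (hist_space G (horizon G)).
           \<psi> (horizon G) (w, y, u) = ennreal (loss G (w, u))"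
    and backward: "\<forall>t\<in>{2..horizon G}. \<forall>x\<in>space (state_space G t).
           \<psi> (t - 1) x = adjoint_op G t (\<gamma> t) (\<psi> t) x"
    and t: "1 \<le> t" "t \<le> horizon G"
  shows "\<psi> t \<in> borel_measurable (costate_space G t)"
  using t(2,1)
proof (induction rule: inc_induct)
  case base
  let ?l = "\<lambda>x. ennreal (loss G (fst x, snd (snd x)))"
  have "loss G \<in> borel_measurable (prior G \<Otimes>\<^sub>M PiM {1..horizon G} (act_space G))"
    using G by (simp add: sequential_team_def)
  moreover have "(\<lambda>x. (fst x, snd (snd x))) \<in>
      hist_space G (horizon G) \<rightarrow>\<^sub>M prior G \<Otimes>\<^sub>M PiM {1..horizon G} (act_space G)"
    unfolding hist_space_def by measurable
  ultimately have "?l \<in> borel_measurable (hist_space G (horizon G))"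
    by (intro measurable_compose[OF _ measurable_ennreal])
       (rule measurable_compose[where g = "loss G"])
  moreover have "\<psi> (horizon G) x = ?l x" if "x \<in> space (hist_space G (horizon G))" for x
    using terminal that by (cases x) auto
  ultimately show ?case
    by (simp add: costate_space_def measurable_cong[of _ "\<psi> (horizon G)" ?l])
next
  case (step n)
  have n: "Suc n \<in> {1..horizon G}" "Suc n \<in> {2..horizon G}"
    using step by auto
  then have "\<gamma> (Suc n) \<in> control_actions G (Suc n)"
    using \<gamma> by (simp add: team_policies_def)
  then have "adjoint_op G (Suc n) (\<gamma> (Suc n)) (\<psi> (Suc n))
      \<in> borel_measurable (state_space G (Suc n))"
    using step by (intro adjoint_op_measurable[OF G n(1)]) auto
  moreover have "\<psi> n x = adjoint_op G (Suc n) (\<gamma> (Suc n)) (\<psi> (Suc n)) x"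
    if "x \<in> space (state_space G (Suc n))" for x
    using bspec[OF bspec[OF backward n(2)] that] by simp
  ultimately show ?case
    using step by (simp add: costate_space_def measurable_cong[of _ "\<psi> n"])
qed

section \<open>Optimality\<close>

theorem theorem3p2:
  fixes G :: "('w, 'y, 'u) team"
    and \<gamma>s :: "nat \<Rightarrow> 'y \<Rightarrow> 'u measure"
    and \<psi> :: "nat \<Rightarrow> 'w \<times> (nat \<Rightarrow> 'y) \<times> (nat \<Rightarrow> 'u) \<Rightarrow> ennreal"
  assumes "sequential_team G"
    and "\<gamma>s \<in> team_policies G"
    and "\<forall>(w, y, u)\<in>space (hist_space G (horizon G)).
           \<psi> (horizon G) (w, y, u) = ennreal (loss G (w, u))"
    and "\<forall>t\<in>{2..horizon G}. \<forall>x\<in>space (state_space G t).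
           \<psi> (t - 1) x = adjoint_op G t (\<gamma>s t) (\<psi> t) x"
    and "\<forall>t\<in>{1..horizon G}. \<forall>\<pi>. admissible G t \<pi> \<longrightarrow>
           (\<integral>\<^sup>+ x. \<psi> t x \<partial>transition G t (\<gamma>s t) \<pi>)
             = (INF g\<in>control_actions G t. \<integral>\<^sup>+ x. \<psi> t x \<partial>transition G t g \<pi>)"
  shows "optimal_policy G \<gamma>s"
proof -
  note G = assms(1) and policy = assms(2) and terminal = assms(3)
    and backward = assms(4) and stationary = assms(5)
  define A where "A \<gamma> t = (\<integral>\<^sup>+ x. \<psi> t x \<partial>transition G t (\<gamma> t) (state_law G \<gamma> t))" for \<gamma> t
  have N: "1 \<le> horizon G"
    using G by (simp add: sequential_team_def)
  have control: "\<gamma> t \<in> control_actions G t" if "\<gamma> \<in> team_policies G" "t \<in> {1..horizon G}" for \<gamma> t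
    using that by (simp add: team_policies_def)
  have cost: "team_cost G \<gamma> = A \<gamma> (horizon G)" if \<gamma>: "\<gamma> \<in> team_policies G" for \<gamma>
  proof -
    have "sets (hist_law G \<gamma> (horizon G)) = sets (hist_space G (horizon G))"
      using hist_law_prob[OF G order_refl] control[OF \<gamma>] by blast
    then have "space (hist_law G \<gamma> (horizon G)) = space (hist_space G (horizon G))"
      by (rule sets_eq_imp_space_eq)
    then show ?thesis
      unfolding team_cost_def A_def transition_horizon[OF N] using terminal
      by (intro nn_integral_cong) auto
  qed
  have improve: "(\<integral>\<^sup>+ x. \<psi> t x \<partial>transition G t (\<gamma>s t) (state_law G \<gamma> t)) \<le> A \<gamma> t"
    if \<gamma>: "\<gamma> \<in> team_policies G" and t: "t \<in> {1..horizon G}" for \<gamma> t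
  proof -
    have "admissible G t (state_law G \<gamma> t)"
      using control[OF \<gamma>] t unfolding admissible_def by (intro exI[of _ \<gamma>]) auto
    then show ?thesis
      using bspec[OF stationary t] control[OF \<gamma> t] unfolding A_def by (auto intro: INF_lower)
  qed
  have duality: "A \<gamma> t = (\<integral>\<^sup>+ x. \<psi> (Suc t) x \<partial>transition G (Suc t) (\<gamma>s (Suc t)) (state_law G \<gamma> (Suc t)))"
    if \<gamma>: "\<gamma> \<in> team_policies G" and t: "1 \<le> t" "t < horizon G" for \<gamma> t
  proof -
    have t': "Suc t \<in> {1..horizon G}" "Suc t \<in> {2..horizon G}"
      using t by auto
    have "\<forall>s\<in>{1..<Suc t}. \<gamma> s \<in> control_actions G s"
      using control[OF \<gamma>] t by auto
    note law = state_law_prob[OF G t'(1) this]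
    have "A \<gamma> t = (\<integral>\<^sup>+ x. \<psi> t x \<partial>state_law G \<gamma> (Suc t))"
      unfolding A_def transition_state_law[OF t] ..
    also have "\<dots> = (\<integral>\<^sup>+ x. adjoint_op G (Suc t) (\<gamma>s (Suc t)) (\<psi> (Suc t)) x \<partial>state_law G \<gamma> (Suc t))"
      using bspec[OF backward t'(2)] sets_eq_imp_space_eq[OF law(1)] by (intro nn_integral_cong) simp
    also have "\<dots> = (\<integral>\<^sup>+ x. \<psi> (Suc t) x \<partial>transition G (Suc t) (\<gamma>s (Suc t)) (state_law G \<gamma> (Suc t)))"
      using t' by (intro adjoint_pairing[OF G t'(1) control[OF policy t'(1)] _ law, symmetric]
          costate_measurable[OF G policy terminal backward]) auto
    finally show ?thesis .
  qed
  have "team_cost G \<gamma>s \<le> team_cost G \<gamma>" if \<gamma>: "\<gamma> \<in> team_policies G" for \<gamma>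
  proof -
    have "A \<gamma>s (horizon G) \<le> A \<gamma> (horizon G)"
      using N
    proof (induction rule: dec_induct)
      case base
      \<comment> \<open>No action precedes the first state, so its law does not depend on the policy.\<close>
      have "state_law G \<gamma>s 1 = state_law G \<gamma> 1"
        by (simp add: state_law_def)
      then show ?case
        using improve[OF \<gamma>, of 1] N by (simp add: A_def)
    next
      case (step t)
      have "A \<gamma>s (Suc t) = A \<gamma>s t"
        using duality[OF policy] step by (simp add: A_def)
      also have "\<dots> \<le> A \<gamma> t"
        by (rule step.IH)
      also have "\<dots> \<le> A \<gamma> (Suc t)"
        using duality[OF \<gamma>] improve[OF \<gamma>, of "Suc t"] step by simp
      finally show ?case .
    qed
    then show ?thesis
      by (simp add: cost \<gamma> policy)
  qed
  then show ?thesis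
    unfolding optimal_policy_def using policy
    by (intro conjI antisym INF_greatest INF_lower) auto
qed

end
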